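(* Let $X$ be an $\mathcal F$-space over $\mathbb K$. Then $X$ belongs to the class $\mathfrak M$ if and only if $X$ is separable and the algebraic dimension of $X'$ is uncountable.
   Context: $\mathbb K$ is either $\mathbb R$ or $\mathbb C$; all vector spaces are over $\mathbb K$ and all topological spaces are assumed Hausdorff. $\mathbb Z_+=\{0,1,2,\dots\}$. An $\mathcal F$-space is a complete metrizable topological vector space (not necessarily locally convex). $X'$ is the space of continuous linear functionals on $X$. A set $A\subset X'$ is equicontinuous if there is a neighborhood $U$ of zero in $X$ with $|f(x)|\le 1$ for all $x\in U$, $f\in A$. Class $\mathfrak M$: a topological vector space $X$ is in $\mathfrak M_0$ if there is a dense linear subspace $Y$ of $X$ admitting a topology $\tau$ stronger than the one inherited from $X$ such that $(Y,\tau)$ is a separable $\mathcal F$-space. $X\in\mathfrak M_1$ if there is a linearly independent equicontinuous sequence $\{f_n\}_{n\in\mathbb Z_+}$ in $X'$. $\mathfrak M=\mathfrak M_0\cap\mathfrak M_1$. *)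

theory Defs
  imports "HOL-Analysis.Analysis" "HOL-Library.Function_Algebras"
begin

text \<open>
  The underlying vector space of a topological vector space is the subspace
  \<open>topspace T\<close> of the ambient type, so that a proper linear subspace with its own
  topology is again an instance of the same locale. The field is meant to be
  \<open>real\<close> or \<open>complex\<close>.
\<close>

locale topological_vector_space = vector_space scale
  for scale :: "'k::real_normed_field \<Rightarrow> 'a::ab_group_add \<Rightarrow> 'a" (infixr "*s" 75) +
  fixes T :: "'a topology"
  assumes subspace_topspace: "subspace (topspace T)"
    and add_continuous: "continuous_map (prod_topology T T) T (\<lambda>(x, y). x + y)"
    and scale_continuous: "continuous_map (prod_topology euclidean T) T (\<lambda>(c, x). c *s x)"
    and Hausdorff: "Hausdorff_space T"
begin

definition cauchy_filter_tvs :: "'a filter \<Rightarrow> bool" where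
  "cauchy_filter_tvs F \<longleftrightarrow>
     F \<noteq> bot \<and> (\<forall>\<^sub>F x in F. x \<in> topspace T) \<and>
     (\<forall>U. openin T U \<and> 0 \<in> U \<longrightarrow> (\<forall>\<^sub>F (x, y) in F \<times>\<^sub>F F. x - y \<in> U))"

text \<open>Completeness refers to the uniformity of the vector topology, not to a chosen metric.\<close>

definition complete_tvs :: bool where
  "complete_tvs \<longleftrightarrow> (\<forall>F. cauchy_filter_tvs F \<longrightarrow> (\<exists>l. limitin T (\<lambda>x. x) l F))"

text \<open>
  Continuous linear functionals are extended by \<open>0\<close> outside \<open>topspace T\<close>; this makes
  the functional unique as a function on the ambient type and keeps the vector space
  operations of the dual pointwise.
\<close>

definition continuous_dual :: "('a \<Rightarrow> 'k) set" where
  "continuous_dual =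
     {f. (\<forall>x\<in>topspace T. \<forall>y\<in>topspace T. f (x + y) = f x + f y) \<and>
         (\<forall>c. \<forall>x\<in>topspace T. f (c *s x) = c * f x) \<and>
         continuous_map T euclidean f \<and>
         (\<forall>x. x \<notin> topspace T \<longrightarrow> f x = 0)}"

definition equicontinuous :: "('a \<Rightarrow> 'k) set \<Rightarrow> bool" where
  "equicontinuous A \<longleftrightarrow>
     A \<subseteq> continuous_dual \<and>
     (\<exists>U. openin T U \<and> 0 \<in> U \<and> (\<forall>f\<in>A. \<forall>x\<in>U. norm (f x) \<le> 1))"

end

locale F_space = topological_vector_space +
  assumes metrizable: "metrizable_space T"
    and complete: "complete_tvs"

definition fun_scale :: "'k::field \<Rightarrow> ('a \<Rightarrow> 'k) \<Rightarrow> 'a \<Rightarrow> 'k" where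
  "fun_scale c f = (\<lambda>x. c * f x)"

interpretation fun_vs: vector_space "fun_scale :: 'k::field \<Rightarrow> ('a \<Rightarrow> 'k) \<Rightarrow> 'a \<Rightarrow> 'k"
  by unfold_locales (simp_all add: fun_scale_def fun_eq_iff algebra_simps)

text \<open>
  The library's \<open>dim\<close> is a natural number and is \<open>0\<close> for every infinite-dimensional
  space, so uncountable dimension is expressed by a Hamel basis of \<open>V\<close>.
\<close>

definition (in vector_space) uncountable_dim :: "'b set \<Rightarrow> bool" where
  "uncountable_dim V \<longleftrightarrow> (\<exists>B. B \<subseteq> V \<and> independent B \<and> span B = V \<and> uncountable B)"

context topological_vector_space
begin

lemma subspace_continuous_dual: "fun_vs.subspace continuous_dual"
proof (rule fun_vs.subspaceI)
  show "0 \<in> continuous_dual"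
    by (simp add: continuous_dual_def zero_fun_def)
next
  fix f g assume fg: "f \<in> continuous_dual" "g \<in> continuous_dual"
  have "continuous_map T euclidean (\<lambda>x. f x + g x)"
    using fg by (intro continuous_map_add) (auto simp: continuous_dual_def)
  then show "f + g \<in> continuous_dual"
    using fg by (auto simp: continuous_dual_def plus_fun_def algebra_simps)
next
  fix c f assume f: "f \<in> continuous_dual"
  have "continuous_map T euclidean (\<lambda>x. c * f x)"
    using f by (intro continuous_map_compose[of T euclidean f euclidean "\<lambda>z. c * z", unfolded o_def])
      (auto simp: continuous_dual_def intro!: continuous_intros)
  then show "fun_scale c f \<in> continuous_dual"
    using f by (auto simp: continuous_dual_def fun_scale_def algebra_simps)
qed

text \<open>
  ``Stronger'' is not meant strictly: \<open>\<tau>\<close> contains every open set of the topology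
  that \<open>Y\<close> inherits from \<open>T\<close>.
\<close>

definition class_M0 :: bool where
  "class_M0 \<longleftrightarrow>
     (\<exists>Y \<tau>. subspace Y \<and> Y \<subseteq> topspace T \<and> T closure_of Y = topspace T \<and>
            topspace \<tau> = Y \<and> (\<forall>U. openin (subtopology T Y) U \<longrightarrow> openin \<tau> U) \<and>
            F_space scale \<tau> \<and> separable_space \<tau>)"

definition class_M1 :: bool where
  "class_M1 \<longleftrightarrow>
     (\<exists>f :: nat \<Rightarrow> 'a \<Rightarrow> 'k. inj f \<and> fun_vs.independent (range f) \<and> equicontinuous (range f))"

definition class_M :: bool where
  "class_M \<longleftrightarrow> class_M0 \<and> class_M1"

end

end

theory Submission
  imports Defs "HOL-Computational_Algebra.Polynomial"
begin

text \<open>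
  If \<open>X'\<close> has uncountable dimension, then one of the countably many polars of a
  neighbourhood base at \<open>0\<close> contains infinitely many elements of a Hamel basis of \<open>X'\<close>.
  Conversely, a linearly independent equicontinuous sequence can be replaced by an
  equicontinuous sequence \<open>e\<close> in triangular position with respect to points \<open>x\<^sub>k\<close>, that is
  \<open>e\<^sub>n x\<^sub>k = 0\<close> for \<open>k < n\<close> and \<open>e\<^sub>n x\<^sub>n \<noteq> 0\<close>. Then \<open>a \<mapsto> \<Sum>n. a\<^sub>n e\<^sub>n\<close> embeds \<open>\<ell>\<^sub>1\<close> into \<open>X'\<close>,
  and the geometric sequences \<open>(t\<^sup>n)\<close>, \<open>0 < t < 1\<close>, are linearly independent in \<open>\<ell>\<^sub>1\<close>.
\<close>

no_notation vector_scalar_mult (infixl \<open>*s\<close> 70)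

section \<open>Linear algebra of scalar-valued functions\<close>

lemma sum_fun_scale_apply:
  "(\<Sum>v\<in>A. fun_scale (u v) (f v)) x = (\<Sum>v\<in>A. u v * f v x)"
  by (induction A rule: infinite_finite_induct) (simp_all add: fun_scale_def)

text \<open>Otherwise restriction to \<open>F\<close> would be injective on the span, embedding an
  infinite independent set into a space of dimension at most the cardinality of
  \<open>F\<close>.\<close>

lemma exists_nonzero_vanishing_on_finite:
  fixes A :: "('a \<Rightarrow> 'k::field) set"
  assumes "infinite A" "fun_vs.independent A" "finite F"
  shows "\<exists>h\<in>fun_vs.span A. h \<noteq> 0 \<and> (\<forall>x\<in>F. h x = 0)"
proof (rule ccontr)
  assume contr: "\<not> ?thesis"
  \<comment> \<open>Restricted functions are extended by zero, so that \<open>R\<close> is an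
    endomorphism of the same function space.\<close>
  define R :: "('a \<Rightarrow> 'k) \<Rightarrow> 'a \<Rightarrow> 'k" where "R h = (\<lambda>x. if x \<in> F then h x else 0)" for h
  interpret R: module_hom fun_scale fun_scale R
    by unfold_locales (auto simp: R_def fun_scale_def fun_eq_iff algebra_simps)
  have inj: "inj_on R (fun_vs.span A)"
    unfolding R.inj_on_iff_eq_0[OF fun_vs.subspace_span]
  proof (intro ballI impI)
    fix h assume h: "h \<in> fun_vs.span A" "R h = 0"
    have "h x = 0" if "x \<in> F" for x
      using fun_cong[OF h(2), of x] that by (simp add: R_def)
    with h(1) contr show "h = 0" by blast
  qed
  \<comment> \<open>The indicators of the points of \<open>F\<close> span the range of
    \<open>R\<close>.\<close>
  define D where "D = (\<lambda>y x. if x = y then (1::'k) else 0) ` F"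
  have "R h \<in> fun_vs.span D" for h
  proof -
    have "R h = (\<Sum>y\<in>F. fun_scale (h y) (\<lambda>x. if x = y then 1 else 0))"
    proof
      fix x
      show "R h x = (\<Sum>y\<in>F. fun_scale (h y) (\<lambda>x. if x = y then 1 else 0)) x"
        using \<open>finite F\<close> by (simp add: sum_fun_scale_apply R_def if_distrib cong: if_cong)
    qed
    also have "\<dots> \<in> fun_vs.span D"
      by (intro fun_vs.span_sum fun_vs.span_scale fun_vs.span_base) (auto simp: D_def)
    finally show ?thesis .
  qed
  then have "R ` A \<subseteq> fun_vs.span D" by blast
  moreover have "fun_vs.independent (R ` A)"
    by (rule R.independent_injective_image[OF assms(2) inj])
  moreover have "finite D"
    using \<open>finite F\<close> by (simp add: D_def)
  ultimately have "finite (R ` A)"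
    using fun_vs.independent_span_bound by blast
  moreover have "inj_on R A"
    using inj fun_vs.span_superset by (rule inj_on_subset)
  ultimately show False
    using \<open>infinite A\<close> finite_image_iff by blast
qed

text \<open>Built recursively: at each stage only finitely many points have been chosen, so some
  nonzero element of the span vanishes at all of them, and a point where it is nonzero is
  added.\<close>

lemma exists_triangular_sequence:
  fixes A :: "('a \<Rightarrow> 'k::field) set"
  assumes "infinite A" "fun_vs.independent A"
  obtains h :: "nat \<Rightarrow> 'a \<Rightarrow> 'k" and x :: "nat \<Rightarrow> 'a"
  where "\<And>n. h n \<in> fun_vs.span A" "\<And>n k. k < n \<Longrightarrow> h n (x k) = 0" "\<And>n. h n (x n) \<noteq> 0"
proof -
  \<comment> \<open>A state of the recursion: earlier points \<open>F\<close>, current function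
    \<open>h\<close>, and the next point \<open>y\<close>.\<close>
  define P :: "'a set \<times> ('a \<Rightarrow> 'k) \<times> 'a \<Rightarrow> bool"
    where "P = (\<lambda>(F, h, y). finite F \<and> h \<in> fun_vs.span A \<and> (\<forall>z\<in>F. h z = 0) \<and> h y \<noteq> 0)"
  have ext: "\<exists>h y. P (F, h, y)" if "finite F" for F
  proof -
    obtain h where "h \<in> fun_vs.span A" "h \<noteq> 0" "\<forall>z\<in>F. h z = 0"
      using exists_nonzero_vanishing_on_finite[OF assms \<open>finite F\<close>] by blast
    moreover from \<open>h \<noteq> 0\<close> obtain y where "h y \<noteq> 0"
      by (auto simp: fun_eq_iff)
    ultimately show ?thesis using that by (auto simp: P_def)
  qed
  have "\<exists>s. \<forall>n. P (s n) \<and> fst (s (Suc n)) = insert (snd (snd (s n))) (fst (s n))"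
  proof (rule dependent_nat_choice)
    show "\<exists>s. P s" using ext[of "{}"] by blast
  next
    fix s and n :: nat assume "P s"
    then have "finite (insert (snd (snd s)) (fst s))" by (auto simp: P_def)
    from ext[OF this] show "\<exists>s'. P s' \<and> fst s' = insert (snd (snd s)) (fst s)" by force
  qed
  then obtain s where s: "\<And>n. P (s n)" "\<And>n. fst (s (Suc n)) = insert (snd (snd (s n))) (fst (s n))"
    by blast
  define h where "h n = fst (snd (s n))" for n
  define x where "x n = snd (snd (s n))" for n
  have mem: "k < n \<Longrightarrow> x k \<in> fst (s n)" for k n
    by (induction n) (auto simp: s(2) x_def less_Suc_eq)
  have Ps: "h n \<in> fun_vs.span A" "z \<in> fst (s n) \<Longrightarrow> h n z = 0" "h n (x n) \<noteq> 0" for n z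
    using s(1)[of n] by (auto simp: P_def h_def x_def split: prod.splits)
  show thesis
    using Ps mem by (intro that[of h x]) auto
qed

text \<open>At \<open>x n\<close> the terms beyond \<open>n\<close> vanish by triangularity and
  those before \<open>n\<close> by induction, leaving only \<open>a n * e n (x n)\<close>.\<close>

lemma triangular_suminf_eq_0:
  fixes e :: "nat \<Rightarrow> 'a \<Rightarrow> 'k::real_normed_field"
  assumes tri: "\<And>n k. k < n \<Longrightarrow> e n (x k) = 0" "\<And>n. e n (x n) \<noteq> 0"
    and zero: "\<And>k. (\<Sum>n. a n * e n (x k)) = 0"
  shows "a n = 0"
proof (induction n rule: less_induct)
  case (less n)
  have "(\<Sum>i. a i * e i (x n)) = (\<Sum>i\<in>{n}. a i * e i (x n))"
  proof (rule suminf_finite)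
    fix i assume "i \<notin> {n}"
    then show "a i * e i (x n) = 0"
      using less.IH[of i] tri(1)[of n i] by (cases i n rule: linorder_cases) auto
  qed simp
  with zero[of n] tri(2)[of n] show ?case by simp
qed

text \<open>A Vandermonde argument: the relation extends from powers to all polynomials and is then
  tested on one that isolates \<open>s\<close>.\<close>

lemma power_combination_eq_0:
  fixes c :: "'k::field \<Rightarrow> 'k"
  assumes "finite S" "\<And>n. (\<Sum>t\<in>S. c t * t ^ n) = 0" "s \<in> S"
  shows "c s = 0"
proof -
  have "(\<Sum>t\<in>S. c t * poly p t) = 0" for p
  proof -
    have "(\<Sum>t\<in>S. c t * poly p t) = (\<Sum>t\<in>S. \<Sum>i\<le>degree p. coeff p i * (c t * t ^ i))"
      by (simp add: poly_altdef sum_distrib_left mult_ac)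
    also have "\<dots> = (\<Sum>i\<le>degree p. \<Sum>t\<in>S. coeff p i * (c t * t ^ i))"
      by (rule sum.swap)
    also have "\<dots> = (\<Sum>i\<le>degree p. coeff p i * (\<Sum>t\<in>S. c t * t ^ i))"
      by (simp add: sum_distrib_left)
    finally show ?thesis using assms(2) by simp
  qed
  \<comment> \<open>Up to normalization this is the Lagrange polynomial of \<open>s\<close>: zero on
    the rest of \<open>S\<close>, nonzero at \<open>s\<close>.\<close>
  from this[of "\<Prod>r\<in>S - {s}. [:- r, 1:]"]
  have "0 = (\<Sum>t\<in>S. c t * (\<Prod>r\<in>S - {s}. t - r))"
    by (simp add: poly_prod)
  also have "\<dots> = (\<Sum>t\<in>{s}. c t * (\<Prod>r\<in>S - {s}. t - r))"
    using assms by (intro sum.mono_neutral_right) auto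
  finally show ?thesis
    using \<open>finite S\<close> by auto
qed

section \<open>Continuous functionals, equicontinuity and separability\<close>

context topological_vector_space
begin

lemma continuous_map_scale_translate:
  assumes "y \<in> topspace T"
  shows "continuous_map T T (\<lambda>x. c *s (x + y))"
proof -
  have "continuous_map T T (\<lambda>x. x + y)"
    using continuous_map_compose[OF _ add_continuous, of T "\<lambda>x. (x, y)"] assms
    by (simp add: continuous_map_paired o_def)
  then show ?thesis
    using continuous_map_compose[OF _ scale_continuous, of T "\<lambda>x. (c, x + y)"]
    by (simp add: continuous_map_paired o_def)
qed

lemma zero_in_topspace: "0 \<in> topspace T"
  using subspace_topspace by (rule subspace_0)

lemma absorbing:
  assumes "openin T U" "0 \<in> U" "x \<in> topspace T"
  obtains c :: 'k where "c \<noteq> 0" "c *s x \<in> U"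
proof -
  have "continuous_map euclidean T (\<lambda>c. c *s x)"
    using continuous_map_compose[OF _ scale_continuous, of euclidean "\<lambda>c. (c, x)"] assms(3)
    by (simp add: continuous_map_paired o_def)
  from openin_continuous_map_preimage[OF this assms(1)]
  have op: "open {c. c *s x \<in> U}" by simp
  have "0 \<in> {c. c *s x \<in> U}" using assms(2) by simp
  with op have "eventually (\<lambda>c. c *s x \<in> U) (nhds 0)"
    unfolding eventually_nhds by blast
  \<comment> \<open>The punctured filter is nontrivial because 0 is not isolated in the field; this
    supplies a nonzero scalar.\<close>
  then have "eventually (\<lambda>c. c *s x \<in> U) (at 0)"
    unfolding eventually_at_filter by (rule eventually_mono) simp
  moreover have "eventually (\<lambda>c::'k. c \<noteq> 0) (at 0)"
    by (simp add: eventually_at_filter)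
  ultimately have "eventually (\<lambda>c. c *s x \<in> U \<and> c \<noteq> 0) (at 0)"
    by (rule eventually_conj)
  with that show thesis
    using eventually_happens'[OF at_neq_bot] by blast
qed

text \<open>Shrinking \<open>U\<close> by a large factor makes \<open>g\<close> small near 0, and
  additivity carries this to every point.\<close>

lemma bounded_functional_in_continuous_dual:
  assumes add: "\<And>x y. x \<in> topspace T \<Longrightarrow> y \<in> topspace T \<Longrightarrow> g (x + y) = g x + g y"
    and scl: "\<And>c x. x \<in> topspace T \<Longrightarrow> g (c *s x) = c * g x"
    and out: "\<And>x. x \<notin> topspace T \<Longrightarrow> g x = 0"
    and U: "openin T U" "0 \<in> U" and bd: "\<And>x. x \<in> U \<Longrightarrow> norm (g x) \<le> M"
  shows "g \<in> continuous_dual"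
proof -
  have "\<exists>V. openin T V \<and> x \<in> V \<and> (\<forall>y\<in>V. g y \<in> ball (g x) \<epsilon>)"
    if x: "x \<in> topspace T" and "\<epsilon> > 0" for x \<epsilon>
  proof -
    have M: "M \<ge> 0" using bd[OF U(2)] norm_ge_zero order_trans by blast
    \<comment> \<open>The summand 1 keeps \<open>r\<close> positive when \<open>M = 0\<close> and
      makes \<open>M < r * \<epsilon>\<close> strict.\<close>
    define r where "r = (M + 1) / \<epsilon>"
    have r: "r > 0" "M < r * \<epsilon>" using M \<open>\<epsilon> > 0\<close> by (simp_all add: r_def)
    have mx: "- x \<in> topspace T" using x subspace_topspace by (rule subspace_neg[rotated])
    \<comment> \<open>This is the neighborhood \<open>x + (1/r) U\<close>, written as a preimage so
      that openness follows from continuity.\<close>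
    define V where "V = {y \<in> topspace T. of_real r *s (y + - x) \<in> U}"
    have "openin T V"
      unfolding V_def
      by (rule openin_continuous_map_preimage[OF continuous_map_scale_translate[OF mx] U(1)])
    moreover have "x \<in> V" using x U(2) by (simp add: V_def)
    moreover have "dist (g x) (g y) < \<epsilon>" if "y \<in> V" for y
    proof -
      have y: "y \<in> topspace T" "of_real r *s (y + - x) \<in> U" using that by (auto simp: V_def)
      have "g (- x) = - g x"
        using scl[OF x, of "- 1"] by simp
      then have "g (of_real r *s (y + - x)) = of_real r * (g y - g x)"
        using y x mx subspace_topspace by (simp add: scl add subspace_add subspace_diff del: add_uminus_conv_diff)
      then have "r * norm (g y - g x) \<le> M"
        using bd[OF y(2)] r(1) by (simp add: norm_mult)
      with r(2) have "r * norm (g y - g x) < r * \<epsilon>" by simp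
      with r(1) show ?thesis by (simp add: dist_norm norm_minus_commute)
    qed
    ultimately show ?thesis by auto
  qed
  then have "continuous_map T euclidean g"
    using Met_TC.continuous_map_to_metric[of T g] by simp
  with add scl out show ?thesis
    by (simp add: continuous_dual_def)
qed

text \<open>A single \<open>U\<close> serves the whole span, and only the bound depends on
  \<open>h\<close>; this permits rescaling to an equicontinuous family.\<close>

lemma bounded_on_span:
  assumes "equicontinuous A"
  obtains U where "openin T U" "0 \<in> U"
    "\<And>h. h \<in> fun_vs.span A \<Longrightarrow> \<exists>M>0. \<forall>x\<in>U. norm (h x) \<le> M"
proof -
  from assms obtain U where U: "openin T U" "0 \<in> U" "\<And>f x. f \<in> A \<Longrightarrow> x \<in> U \<Longrightarrow> norm (f x) \<le> 1"
    by (auto simp: equicontinuous_def)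
  have "\<exists>M>0. \<forall>x\<in>U. norm (h x) \<le> M" if "h \<in> fun_vs.span A" for h
    using that
  proof (induction rule: fun_vs.span_induct_alt)
    case base
    show ?case by (intro exI[of _ 1]) simp
  next
    case (step c f h)
    then obtain M where M: "M > 0" "\<forall>x\<in>U. norm (h x) \<le> M" by blast
    have "norm (c * f x + h x) \<le> norm c + M" if "x \<in> U" for x
    proof -
      have "norm (c * f x) \<le> norm c"
        using U(3)[OF step(1) that] by (simp add: norm_mult mult_left_le)
      with M(2) that show ?thesis by (intro norm_triangle_mono) auto
    qed
    with M(1) show ?case
      by (intro exI[of _ "norm c + M"]) (auto simp: fun_scale_def add_nonneg_pos)
  qed
  with U that show thesis by blast
qed

text \<open>Dividing each triangular function by its bound on the common neighborhood gives
  equicontinuity and preserves the pattern of zeros.\<close>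

lemma equicontinuous_triangular_sequence:
  assumes "class_M1"
  obtains e :: "nat \<Rightarrow> 'a \<Rightarrow> 'k" and x :: "nat \<Rightarrow> 'a"
  where "equicontinuous (range e)" "\<And>n k. k < n \<Longrightarrow> e n (x k) = 0" "\<And>n. e n (x n) \<noteq> 0"
proof -
  from assms obtain f :: "nat \<Rightarrow> 'a \<Rightarrow> 'k"
    where f: "inj f" "fun_vs.independent (range f)" "equicontinuous (range f)"
    by (auto simp: class_M1_def)
  obtain h :: "nat \<Rightarrow> 'a \<Rightarrow> 'k" and x :: "nat \<Rightarrow> 'a"
    where h: "\<And>n. h n \<in> fun_vs.span (range f)" "\<And>n k. k < n \<Longrightarrow> h n (x k) = 0" "\<And>n. h n (x n) \<noteq> 0"
    using exists_triangular_sequence[OF range_inj_infinite[OF f(1)] f(2)] by blast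
  obtain U where U: "openin T U" "0 \<in> U"
    "\<And>g. g \<in> fun_vs.span (range f) \<Longrightarrow> \<exists>M>0. \<forall>x\<in>U. norm (g x) \<le> M"
    using bounded_on_span[OF f(3)] by blast
  have "\<forall>n. \<exists>M>0. \<forall>x\<in>U. norm (h n x) \<le> M" using U(3) h(1) by blast
  then obtain M :: "nat \<Rightarrow> real" where M: "\<And>n. M n > 0" "\<And>n x. x \<in> U \<Longrightarrow> norm (h n x) \<le> M n"
    by metis
  define e where "e n = fun_scale (of_real (1 / M n)) (h n)" for n
  have dual: "fun_vs.span (range f) \<subseteq> continuous_dual"
    using f(3) subspace_continuous_dual by (intro fun_vs.span_minimal) (simp_all add: equicontinuous_def)
  have "e n \<in> continuous_dual" for n
    using dual h(1) by (auto simp: e_def intro: fun_vs.subspace_scale[OF subspace_continuous_dual])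
  moreover have "norm (e n y) \<le> 1" if "y \<in> U" for n y
    using M(1)[of n] M(2)[OF that, of n]
    by (simp add: e_def fun_scale_def norm_mult norm_divide divide_simps)
  ultimately have "equicontinuous (range e)"
    using U(1,2) by (auto simp: equicontinuous_def)
  moreover have "e n (x k) = 0" if "k < n" for n k
    using h(2)[OF that] by (simp add: e_def fun_scale_def)
  moreover have "e n (x n) \<noteq> 0" for n
    using h(3)[of n] M(1)[of n] by (simp add: e_def fun_scale_def)
  ultimately show thesis by (rule that)
qed

text \<open>A countable set dense for \<tau> stays dense in \<open>Y\<close> for the coarser
  inherited topology, and \<open>Y\<close> is dense in the space.\<close>

lemma class_M0_imp_separable:
  assumes "class_M0"
  shows "separable_space T"
proof -
  from assms obtain Y \<tau> where Y: "Y \<subseteq> topspace T" "T closure_of Y = topspace T" "topspace \<tau> = Y"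
    and fine: "\<And>U. openin (subtopology T Y) U \<Longrightarrow> openin \<tau> U" and "separable_space \<tau>"
    by (auto simp: class_M0_def)
  then obtain D where D: "countable D" "D \<subseteq> Y" "\<tau> closure_of D = Y"
    by (auto simp: separable_space_def)
  have "Y \<subseteq> T closure_of D"
  proof
    fix y assume y: "y \<in> Y"
    have "\<exists>d. d \<in> D \<and> d \<in> U" if "y \<in> U" "openin T U" for U
    proof -
      have "openin \<tau> (U \<inter> Y)"
        using that by (intro fine) (auto simp: openin_subtopology)
      moreover have "y \<in> \<tau> closure_of D" using y D(3) by simp
      ultimately show ?thesis using y that(1) unfolding in_closure_of by blast
    qed
    then show "y \<in> T closure_of D" using y Y(1) by (auto simp: in_closure_of)
  qed
  then have "T closure_of Y \<subseteq> T closure_of D"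
    by (simp add: closure_of_minimal)
  then have "T closure_of D = topspace T"
    using Y(2) closure_of_subset_topspace[of T D] by auto
  with D Y(1) show ?thesis by (auto simp: separable_space_def)
qed

lemma uncountable_dim_imp_class_M1:
  assumes "first_countable T" "fun_vs.uncountable_dim continuous_dual"
  shows "class_M1"
proof -
  obtain \<B> where \<B>: "countable \<B>" "\<And>V. V \<in> \<B> \<Longrightarrow> openin T V"
    "\<And>U. openin T U \<Longrightarrow> 0 \<in> U \<Longrightarrow> \<exists>V\<in>\<B>. 0 \<in> V \<and> V \<subseteq> U"
    using assms(1) zero_in_topspace unfolding first_countable_def by metis
  obtain B where B: "B \<subseteq> continuous_dual" "fun_vs.independent B" "uncountable B"
    using assms(2) by (auto simp: fun_vs.uncountable_dim_def)
  \<comment> \<open>The part of the Hamel basis lying in the polar of \<open>V\<close>.\<close>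
  define C where "C V = {f \<in> B. \<forall>x\<in>V. norm (f x) \<le> 1}" for V
  \<comment> \<open>Members of \<B> may miss 0, so the union selects those that are neighborhoods of
    0.\<close>
  have "B \<subseteq> (\<Union>V\<in>{V\<in>\<B>. 0 \<in> V}. C V)"
  proof
    fix f assume f: "f \<in> B"
    with B(1) have cont: "continuous_map T euclidean f" and "f (0 *s 0) = 0 * f 0"
      using zero_in_topspace by (auto simp: continuous_dual_def simp del: scale_zero_left scale_zero_right)
    then have "f 0 = 0" by simp
    define W where "W = {x \<in> topspace T. f x \<in> ball 0 1}"
    have "openin T W"
      unfolding W_def using cont by (rule openin_continuous_map_preimage) simp
    moreover have "0 \<in> W" using \<open>f 0 = 0\<close> zero_in_topspace by (simp add: W_def)
    ultimately obtain V where V: "V \<in> \<B>" "0 \<in> V" "V \<subseteq> W" using \<B>(3) by blast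
    have "f \<in> C V" using f V(3) by (auto simp: C_def W_def)
    with V show "f \<in> (\<Union>V\<in>{V\<in>\<B>. 0 \<in> V}. C V)" by blast
  qed
  with B(3) have "uncountable (\<Union>V\<in>{V\<in>\<B>. 0 \<in> V}. C V)"
    using countable_subset by blast
  then obtain V where V: "V \<in> \<B>" "0 \<in> V" "uncountable (C V)"
    using countable_UN[of "{V\<in>\<B>. 0 \<in> V}" C] countable_Collect[OF \<B>(1)] by auto
  have "infinite (C V)" using V(3) countable_finite by blast
  then obtain f :: "nat \<Rightarrow> 'a \<Rightarrow> 'k" where f: "inj f" "range f \<subseteq> C V"
    using infinite_countable_subset by blast
  have "fun_vs.independent (range f)"
    using f(2) by (intro fun_vs.independent_mono[OF B(2)]) (auto simp: C_def)
  moreover have "equicontinuous (range f)"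
    unfolding equicontinuous_def
  proof (intro conjI exI[of _ V])
    show "range f \<subseteq> continuous_dual" using f(2) B(1) by (auto simp: C_def)
    show "\<forall>f\<in>range f. \<forall>x\<in>V. norm (f x) \<le> 1" using f(2) unfolding C_def by blast
  qed (use V \<B>(2) in auto)
  ultimately show ?thesis using f(1) by (auto simp: class_M1_def)
qed

end

section \<open>Series of functionals over a complete scalar field\<close>

locale banach_topological_vector_space = topological_vector_space scale T
  for scale :: "'k::{real_normed_field, banach} \<Rightarrow> 'a::ab_group_add \<Rightarrow> 'a" (infixr "*s" 75)
    and T :: "'a topology"
begin

text \<open>A nonzero multiple of \<open>x\<close> lies in the common neighborhood, where the terms
  are dominated by \<open>norm (a n)\<close>; the scalar is then cancelled.\<close>

lemma summable_equicontinuous: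
  assumes "equicontinuous (range e)" "summable (\<lambda>n. norm (a n))"
  shows "summable (\<lambda>n. a n * e n x)"
proof (cases "x \<in> topspace T")
  case True
  obtain U where U: "openin T U" "0 \<in> U" "\<And>n y. y \<in> U \<Longrightarrow> norm (e n y) \<le> 1"
    using assms(1) by (auto simp: equicontinuous_def)
  obtain c where c: "c \<noteq> 0" "c *s x \<in> U"
    using absorbing[OF U(1,2) True] by blast
  have "e n \<in> continuous_dual" for n
    using assms(1) by (auto simp: equicontinuous_def)
  then have "c * e n x = e n (c *s x)" for n
    using True by (auto simp: continuous_dual_def)
  then have "norm (c * (a n * e n x)) \<le> norm (a n)" for n
    using U(3)[OF c(2), of n] by (simp add: mult.left_commute[of c] norm_mult[of "a n"] mult_left_le)
  then have "summable (\<lambda>n. c * (a n * e n x))"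
    by (intro summable_comparison_test'[OF assms(2)])
  with c(1) show ?thesis by (simp add: summable_cmult_iff)
next
  case False
  then have "e n x = 0" for n
    using assms(1) by (auto simp: equicontinuous_def continuous_dual_def)
  then show ?thesis by simp
qed

text \<open>On the common neighborhood the sum is bounded by the \<ell>1 norm of \<open>a\<close>,
  and boundedness there gives continuity.\<close>

lemma suminf_in_continuous_dual:
  assumes e: "equicontinuous (range e)" and a: "summable (\<lambda>n. norm (a n))"
  shows "(\<lambda>x. \<Sum>n. a n * e n x) \<in> continuous_dual"
proof -
  obtain U where U: "openin T U" "0 \<in> U" "\<And>n y. y \<in> U \<Longrightarrow> norm (e n y) \<le> 1"
    using e by (auto simp: equicontinuous_def)
  have dual: "e n \<in> continuous_dual" for n
    using e by (auto simp: equicontinuous_def)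
  note sm = summable_equicontinuous[OF e a]
  show ?thesis
  proof (rule bounded_functional_in_continuous_dual[OF _ _ _ U(1,2)])
    fix x y assume "x \<in> topspace T" "y \<in> topspace T"
    then have "e n (x + y) = e n x + e n y" for n
      using dual[of n] by (auto simp: continuous_dual_def)
    then show "(\<Sum>n. a n * e n (x + y)) = (\<Sum>n. a n * e n x) + (\<Sum>n. a n * e n y)"
      by (simp add: suminf_add[OF sm sm] distrib_left)
  next
    fix c x assume "x \<in> topspace T"
    then have "e n (c *s x) = c * e n x" for n
      using dual[of n] by (auto simp: continuous_dual_def)
    then show "(\<Sum>n. a n * e n (c *s x)) = c * (\<Sum>n. a n * e n x)"
      by (simp add: suminf_mult[OF sm, symmetric] mult.left_commute)
  next
    fix x assume "x \<notin> topspace T"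
    then have "e n x = 0" for n
      using dual[of n] by (auto simp: continuous_dual_def)
    then show "(\<Sum>n. a n * e n x) = 0" by simp
  next
    fix x assume "x \<in> U"
    then have le: "norm (a n * e n x) \<le> norm (a n)" for n
      using U(3) by (simp add: norm_mult mult_left_le)
    have sm_norm: "summable (\<lambda>n. norm (a n * e n x))"
      by (rule summable_comparison_test'[OF a, of 0]) (use le in auto)
    then have "norm (\<Sum>n. a n * e n x) \<le> (\<Sum>n. norm (a n * e n x))"
      by (rule summable_norm)
    also have "\<dots> \<le> (\<Sum>n. norm (a n))"
      by (rule suminf_le[OF le sm_norm a])
    finally show "norm (\<Sum>n. a n * e n x) \<le> (\<Sum>n. norm (a n))" .
  qed
qed

lemma class_M1_imp_uncountable_dim:
  assumes "class_M1"
  shows "fun_vs.uncountable_dim continuous_dual"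
proof -
  obtain e :: "nat \<Rightarrow> 'a \<Rightarrow> 'k" and x :: "nat \<Rightarrow> 'a"
    where e: "equicontinuous (range e)"
      and tri: "\<And>n k. k < n \<Longrightarrow> e n (x k) = 0" "\<And>n. e n (x n) \<noteq> 0"
    using equicontinuous_triangular_sequence[OF assms] by blast
  \<comment> \<open>Uncountably many scalars, all with absolutely summable geometric
    sequences.\<close>
  define S :: "'k set" where "S = of_real ` {0<..<1}"
  define g where "g t = (\<lambda>y. \<Sum>n. t ^ n * e n y)" for t
  have smS: "summable (\<lambda>n. norm (t ^ n))" if "t \<in> S" for t
    using that by (auto simp: S_def norm_power summable_geometric)
  have gd: "g t \<in> continuous_dual" if "t \<in> S" for t
    unfolding g_def by (rule suminf_in_continuous_dual[OF e smS[OF that]])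
  \<comment> \<open>Evaluating the relation at \<open>x k\<close> and exchanging the sums gives a
    series in \<open>e\<close> with coefficients \<open>\<Sum>t\<in>F. c t * t ^ n\<close>.
    Triangularity forces these to vanish, and then the powers force \<open>c\<close> to vanish on
    \<open>F\<close>.\<close>
  have indep: "c s = 0"
    if F: "finite F" "F \<subseteq> S" "s \<in> F" and z: "\<And>y. (\<Sum>t\<in>F. c t * g t y) = 0" for F c s
  proof (rule power_combination_eq_0[OF F(1) _ F(3)])
    fix n
    show "(\<Sum>t\<in>F. c t * t ^ n) = 0"
    proof (rule triangular_suminf_eq_0[where e = e and x = x, OF tri])
      fix k
      have sm: "summable (\<lambda>n. t ^ n * e n (x k))" if "t \<in> F" for t
        using summable_equicontinuous[OF e smS] that F(2) by blast
      have "(\<Sum>n. (\<Sum>t\<in>F. c t * t ^ n) * e n (x k)) = (\<Sum>n. \<Sum>t\<in>F. c t * (t ^ n * e n (x k)))"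
        by (simp add: sum_distrib_right mult.assoc)
      also have "\<dots> = (\<Sum>t\<in>F. \<Sum>n. c t * (t ^ n * e n (x k)))"
        using sm by (intro suminf_sum summable_mult)
      also have "\<dots> = (\<Sum>t\<in>F. c t * g t (x k))"
        using sm by (intro sum.cong) (simp_all add: g_def suminf_mult)
      finally show "(\<Sum>n. (\<Sum>t\<in>F. c t * t ^ n) * e n (x k)) = 0"
        using z by simp
    qed
  qed
  have inj: "inj_on g S"
  proof (rule inj_onI, rule ccontr)
    fix s t assume st: "s \<in> S" "t \<in> S" "g s = g t" "s \<noteq> t"
    \<comment> \<open>If \<open>g s = g t\<close>, the coefficients 1 at \<open>s\<close> and -1 at
      \<open>t\<close> form a forbidden relation.\<close>
    have "(if s = s then 1 else - 1 :: 'k) = 0"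
      by (rule indep[of "{s, t}" s "\<lambda>r. if r = s then 1 else - 1"]) (use st in auto)
    then show False by simp
  qed
  have "fun_vs.independent (g ` S)"
    unfolding fun_vs.independent_explicit_module
  proof (intro allI impI)
    fix G u v
    assume G: "finite G" "G \<subseteq> g ` S" "(\<Sum>w\<in>G. fun_scale (u w) w) = 0" "v \<in> G"
    obtain F where F: "F \<subseteq> S" "finite F" "G = g ` F"
      using finite_subset_image[OF G(1,2)] by blast
    have injF: "inj_on g F" using inj F(1) by (rule inj_on_subset)
    obtain s where s: "s \<in> F" "v = g s" using G(4) F(3) by blast
    have "u (g s) = 0"
    proof (rule indep[OF F(2,1) s(1), where c = "\<lambda>t. u (g t)"])
      fix y
      have "(\<Sum>w\<in>G. u w * w y) = 0"
        using fun_cong[OF G(3), of y] by (simp add: sum_fun_scale_apply)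
      then show "(\<Sum>t\<in>F. u (g t) * g t y) = 0"
        by (simp add: F(3) sum.reindex[OF injF])
    qed
    with s(2) show "u v = 0" by simp
  qed
  \<comment> \<open>\<open>uncountable_dim\<close> asks for a basis of the whole dual, so the
    uncountable independent family is extended to one.\<close>
  then obtain B where B: "g ` S \<subseteq> B" "B \<subseteq> continuous_dual" "fun_vs.independent B"
    "continuous_dual \<subseteq> fun_vs.span B"
    using fun_vs.maximal_independent_subset_extend[of "g ` S" continuous_dual] gd by blast
  have "uncountable S"
    unfolding S_def
    using countable_image_inj_on[of "of_real :: real \<Rightarrow> 'k" "{0<..<1}"] uncountable_open_interval[of 0 "1::real"]
    by (auto simp: inj_on_def)
  with inj B(1) have "uncountable B"
    using countable_image_inj_on countable_subset by blast
  moreover have "fun_vs.span B = continuous_dual"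
    using B(2,4) fun_vs.span_minimal[OF B(2) subspace_continuous_dual] by blast
  ultimately show ?thesis
    using B(2,3) by (auto simp: fun_vs.uncountable_dim_def)
qed

end

text \<open>The sort \<open>banach\<close> covers the real and complex cases at once.\<close>

lemma F_space_class_M_iff:
  fixes scale :: "'k::{real_normed_field, banach} \<Rightarrow> 'a::ab_group_add \<Rightarrow> 'a"
  assumes "F_space scale T"
  shows "topological_vector_space.class_M scale T \<longleftrightarrow>
    separable_space T \<and> fun_vs.uncountable_dim (topological_vector_space.continuous_dual scale T)"
proof -
  interpret F_space scale T by fact
  interpret banach_topological_vector_space scale T by unfold_locales
  \<comment> \<open>A separable F-space is its own witness: \<open>Y\<close> is the whole space and
    \<tau> is \<open>T\<close>.\<close>
  have "class_M0" if "separable_space T"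
    unfolding class_M0_def
    using that assms subspace_topspace by (intro exI[of _ "topspace T"] exI[of _ T]) simp
  then show ?thesis
    using class_M0_imp_separable class_M1_imp_uncountable_dim uncountable_dim_imp_class_M1
      metrizable_imp_first_countable[OF metrizable]
    by (auto simp: class_M_def)
qed

theorem proposition1p5:
  fixes scale\<^sub>r :: "real \<Rightarrow> 'a::ab_group_add \<Rightarrow> 'a" and X\<^sub>r :: "'a topology"
    and scale\<^sub>c :: "complex \<Rightarrow> 'b::ab_group_add \<Rightarrow> 'b" and X\<^sub>c :: "'b topology"
  shows
    "(F_space scale\<^sub>r X\<^sub>r \<longrightarrow>
        (topological_vector_space.class_M scale\<^sub>r X\<^sub>r \<longleftrightarrow>
           separable_space X\<^sub>r \<and>
           fun_vs.uncountable_dim (topological_vector_space.continuous_dual scale\<^sub>r X\<^sub>r))) \<and>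
     (F_space scale\<^sub>c X\<^sub>c \<longrightarrow>
        (topological_vector_space.class_M scale\<^sub>c X\<^sub>c \<longleftrightarrow>
           separable_space X\<^sub>c \<and>
           fun_vs.uncountable_dim (topological_vector_space.continuous_dual scale\<^sub>c X\<^sub>c)))"
  by (simp add: F_space_class_M_iff)

end
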